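(* Let $\sigma_0\in C^2(\mathbb{R}^n;\mathbb{R}^n)$, let $\sigma=(\sigma_1,\dots,\sigma_m):\mathbb{R}^n\to\mathbb{R}^{n\times m}$ be of class $C^2$ and let $u:\mathbb{R}^n\to\mathbb{R}$ be of class $C^3$. Let $\bar x\in\mathbb{R}^n$ be a point such that $\nabla u(\bar x)\ne0$ and $\nabla u(\bar x)\cdot\sigma_i(\bar x)=0$ for $i=0,1,\dots,m$. Suppose moreover that $\nabla(\nabla u\cdot\sigma_0)\cdot\sigma_0(\bar x)\le0$. Let $T$ be the minimum time function of the nonlinear affine system $\dot x_t=\sigma_0(x_t)+\sigma(x_t)a_t$, with controls valued in $B_1(0)=\{a\in\mathbb{R}^m:|a|\le1\}$, for the target $\mathcal T=\{x:u(x)\le u(\bar x)\}$. If for some $C,r>0$ and $s\in(1/3,1/2]$ one has $T(x)\le C|x-\bar x|^s$ for all $x\in B_r(\bar x)$, then at least one of the following holds: (1) there is $j\in\{1,\dots,m\}$ such that $[\sigma_0,\sigma_j](\bar x)\cdot\nabla u(\bar x)\ne0$, or $K(\bar x)$ is not positive semidefinite; (2) there is $a\in B_1(0)$ such that $\nabla\big(\nabla u\cdot(\sigma_0+\sigma a)\big)\cdot(\sigma_0+\sigma a)(\bar x)<0$.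
   Context: Controls $a_\cdot:[0,+\infty)\to B_1(0)$ are piecewise constant (finitely many pieces on bounded intervals); trajectories are solutions of the system on their maximal interval of existence. Minimum time function: $T(x)=\inf_{a_\cdot}t_x(a_\cdot)$, $t_x(a_\cdot)=\inf\{t\ge0:x_t\in\mathcal T\}$ with $x_0=x$ ($\inf\emptyset=+\infty$). $B_r(x)$ is the closed ball. Lie bracket: $[f,g]=Dg\,f-Df\,g$, with $Df=(\partial_{x_j}f_i)_{i,j}$ the Jacobian. The matrix $K$ is built from $\sigma$ only (not from the drift $\sigma_0$): let $S(x)$ be the $m\times m$ matrix with entries $S_{i,j}(x)=\nabla(\nabla u\cdot\sigma_i)(x)\cdot\sigma_j(x)$, $i,j=1,\dots,m$, let $S^*=\frac12(S+{}^tS)$ and $$K(x)=\begin{pmatrix}S^*(x)&{}^tS(x)\\S(x)&S^*(x)\end{pmatrix}.$$ *)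

theory Defs
  imports "HOL-Analysis.Analysis"
begin

text \<open>
  Class \<open>C\<^sup>k\<close> on the whole space, via partial derivatives. Asking for differentiability below order
  \<open>k\<close>, and not just partial derivatives, is no restriction when those are continuous.
\<close>

primrec Ck :: "nat \<Rightarrow> ('a::euclidean_space \<Rightarrow> 'b::real_normed_vector) \<Rightarrow> bool" where
  "Ck 0 f \<longleftrightarrow> continuous_on UNIV f"
| "Ck (Suc k) f \<longleftrightarrow> (\<forall>x. f differentiable (at x)) \<and>
     (\<forall>b\<in>Basis. Ck k (\<lambda>x. frechet_derivative f (at x) b))"

definition grad :: "(real^'n \<Rightarrow> real) \<Rightarrow> real^'n \<Rightarrow> real^'n" where
  "grad u x = (\<chi> i. frechet_derivative u (at x) (axis i 1))"

definition lie_bracket ::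
  "(real^'n \<Rightarrow> real^'n) \<Rightarrow> (real^'n \<Rightarrow> real^'n) \<Rightarrow> real^'n \<Rightarrow> real^'n" where
  "lie_bracket f g x = jacobian g (at x) *v f x - jacobian f (at x) *v g x"

text \<open>
  A map \<open>\<sigma>\<close> into the \<open>n \<times> m\<close> matrices (type \<^typ>\<open>real^'m^'n\<close>) stands for the \<open>m\<close> vector fields
  \<open>\<lambda>x. column j (\<sigma> x)\<close>.
\<close>

definition S_mat :: "(real^'n \<Rightarrow> real) \<Rightarrow> (real^'n \<Rightarrow> real^'m^'n) \<Rightarrow> real^'n \<Rightarrow> real^'m^'m" where
  "S_mat u \<sigma> x =
     (\<chi> i j. grad (\<lambda>y. grad u y \<bullet> column i (\<sigma> y)) x \<bullet> column j (\<sigma> x))"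

definition sym_part :: "real^'m^'m \<Rightarrow> real^'m^'m" where
  "sym_part S = (1/2) *\<^sub>R (S + transpose S)"

text \<open>\<open>2m \<times> 2m\<close> matrices are indexed by \<^typ>\<open>'m + 'm\<close>: \<open>Inl\<close> is the first block, \<open>Inr\<close> the second.\<close>

definition block_mat ::
  "real^'m^'m \<Rightarrow> real^'m^'m \<Rightarrow> real^'m^'m \<Rightarrow> real^'m^'m \<Rightarrow> real^('m + 'm)^('m + 'm)" where
  "block_mat A B C D = (\<chi> p q.
     case p of
       Inl i \<Rightarrow> (case q of Inl j \<Rightarrow> A $ i $ j | Inr j \<Rightarrow> B $ i $ j)
     | Inr i \<Rightarrow> (case q of Inl j \<Rightarrow> C $ i $ j | Inr j \<Rightarrow> D $ i $ j))"

definition K_mat ::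
  "(real^'n \<Rightarrow> real) \<Rightarrow> (real^'n \<Rightarrow> real^'m^'n) \<Rightarrow> real^'n \<Rightarrow> real^('m + 'm)^('m + 'm)" where
  "K_mat u \<sigma> x =
     block_mat (sym_part (S_mat u \<sigma> x)) (transpose (S_mat u \<sigma> x))
               (S_mat u \<sigma> x) (sym_part (S_mat u \<sigma> x))"

definition pos_semidef :: "real^'k^'k \<Rightarrow> bool" where
  "pos_semidef A \<longleftrightarrow> transpose A = A \<and> (\<forall>v. 0 \<le> v \<bullet> (A *v v))"

text \<open>Only the values of a control on \<open>[0,\<infinity>)\<close> matter; the pieces may be arbitrary intervals.\<close>

definition admissible_control :: "(real \<Rightarrow> real^'m) \<Rightarrow> bool" where
  "admissible_control a \<longleftrightarrow>
     (\<forall>t\<ge>0. a t \<in> cball 0 1) \<and>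
     (\<forall>b\<ge>0. \<exists>P. finite P \<and> \<Union>P = {0..b} \<and> (\<forall>I\<in>P. is_interval I \<and> a constant_on I))"

text \<open>
  \<open>y\<close> solves \<open>y' = \<sigma>\<^sub>0(y) + \<sigma>(y) a\<close>, \<open>y(0) = x\<close>, on \<open>[0,\<tau>)\<close> with \<open>0 < \<tau> \<le> \<infinity>\<close>. The equation is
  in integral form, since \<open>y\<close> need not be differentiable where the control jumps; at \<open>t = 0\<close> it
  gives the initial condition.
\<close>

definition solution_on ::
  "(real^'n \<Rightarrow> real^'n) \<Rightarrow> (real^'n \<Rightarrow> real^'m^'n) \<Rightarrow> (real \<Rightarrow> real^'m) \<Rightarrow> real^'n
    \<Rightarrow> ereal \<Rightarrow> (real \<Rightarrow> real^'n) \<Rightarrow> bool" where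
  "solution_on \<sigma>0 \<sigma> a x \<tau> y \<longleftrightarrow> 0 < \<tau> \<and>
     (\<forall>t\<ge>0. ereal t < \<tau> \<longrightarrow>
        ((\<lambda>s. \<sigma>0 (y s) + \<sigma> (y s) *v a s) has_integral (y t - x)) {0..t})"

definition trajectory ::
  "(real^'n \<Rightarrow> real^'n) \<Rightarrow> (real^'n \<Rightarrow> real^'m^'n) \<Rightarrow> (real \<Rightarrow> real^'m) \<Rightarrow> real^'n
    \<Rightarrow> ereal \<Rightarrow> (real \<Rightarrow> real^'n) \<Rightarrow> bool" where
  "trajectory \<sigma>0 \<sigma> a x \<tau> y \<longleftrightarrow> solution_on \<sigma>0 \<sigma> a x \<tau> y \<and>
     \<not> (\<exists>\<tau>' z. \<tau> < \<tau>' \<and> solution_on \<sigma>0 \<sigma> a x \<tau>' z \<and>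
           (\<forall>t\<ge>0. ereal t < \<tau> \<longrightarrow> z t = y t))"

text \<open>
  For locally Lipschitz fields the maximal trajectory is unique on \<open>[0,\<tau>)\<close>, so the existential
  quantifier below just names it. The infimum of the empty set in \<^typ>\<open>ereal\<close> is \<open>\<infinity>\<close>.
\<close>

definition hitting_time ::
  "(real^'n \<Rightarrow> real^'n) \<Rightarrow> (real^'n \<Rightarrow> real^'m^'n) \<Rightarrow> (real^'n) set
    \<Rightarrow> real^'n \<Rightarrow> (real \<Rightarrow> real^'m) \<Rightarrow> ereal" where
  "hitting_time \<sigma>0 \<sigma> \<T> x a =
     Inf {ereal t | t. 0 \<le> t \<and> (\<exists>\<tau> y. trajectory \<sigma>0 \<sigma> a x \<tau> y \<and> ereal t < \<tau> \<and> y t \<in> \<T>)}"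

definition min_time ::
  "(real^'n \<Rightarrow> real^'n) \<Rightarrow> (real^'n \<Rightarrow> real^'m^'n) \<Rightarrow> (real^'n) set \<Rightarrow> real^'n \<Rightarrow> ereal" where
  "min_time \<sigma>0 \<sigma> \<T> x = (INF a\<in>Collect admissible_control. hitting_time \<sigma>0 \<sigma> \<T> x a)"

end

theory Submission
  imports Defs
begin

text \<open>
  Suppose that neither alternative holds. Write \<open>X\<^sub>0 = \<sigma>\<^sub>0\<close>, \<open>X\<^sub>1, \<dots>, X\<^sub>m\<close> for the drift and the columns
  of \<open>\<sigma>\<close>, and \<open>S\<^sub>k\<^sub>l = X\<^sub>l (X\<^sub>k u)\<close>, the second-order derivatives of \<open>u\<close> along these fields at the point
  \<open>xbar\<close>, now with \<open>0\<close> among the indices. They enter because the drift is one more field, driven by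
  the constant control \<open>1\<close>: along a trajectory \<open>u\<close> changes at the rate \<open>\<Sum>\<^sub>k b\<^sub>k (X\<^sub>k u)\<close> with
  \<open>b = (1, a)\<close>, and near \<open>xbar\<close> each \<open>X\<^sub>k u\<close>, which vanishes at \<open>xbar\<close>, changes at the rate
  \<open>\<Sum>\<^sub>l b\<^sub>l S\<^sub>k\<^sub>l\<close> up to an error of the order of the distance to \<open>xbar\<close>.
  
  The failure of the two alternatives makes the matrix \<open>S\<close> symmetric and positive semidefinite. Indeed
  \<open>a = 0\<close> in (2), with the hypothesis on the drift, gives \<open>S\<^sub>0\<^sub>0 = 0\<close>; then small multiples of a basis
  vector give \<open>S\<^sub>0\<^sub>i + S\<^sub>i\<^sub>0 = 0\<close>; and the bracket condition says \<open>S\<^sub>i\<^sub>0 = S\<^sub>0\<^sub>i\<close>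
  (\<open>lie_deriv_commutator\<close>), so the row and the column of the drift vanish. For the remaining block,
  the quadratic form of \<open>K\<close> vanishes at all vectors \<open>(v, -v)\<close>; if it is positive semidefinite, its first
  variations there vanish too, which is the symmetry of the block, and \<open>(v, v)\<close> gives its positivity
  (\<open>pos_semidef_block_imp\<close>).
  
  When \<open>S\<close> is symmetric, the second-order term of \<open>u\<close> along a trajectory depends on the control only
  through its primitive \<open>B = \<integral> b\<close>: it is the integral of \<open>b \<bullet> S B\<close>, that is
  \<open>1/2 (B \<bullet> S B) \<ge> 0\<close>. So no control lowers \<open>u\<close> at second order, and from a point at distance
  \<open>\<epsilon>\<close> a trajectory lowers \<open>u\<close> in time \<open>t\<close> by at most a constant times \<open>t \<epsilon> + t\<^sup>3\<close>
  (\<open>second_order_lower_bound\<close>). Starting from \<open>xbar\<close> displaced by \<open>\<epsilon>\<close> along the gradient, \<open>u\<close> has to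
  drop by about \<open>\<epsilon> |\<nabla>u|\<close> within a time of order \<open>\<epsilon>\<^sup>s\<close>. For \<open>s > 1/3\<close> both \<open>t \<epsilon>\<close> and \<open>t\<^sup>3\<close> are
  then \<open>o(\<epsilon>)\<close>, a contradiction for small \<open>\<epsilon>\<close>.
\<close>

section \<open>Functions of class \<open>C\<^sup>k\<close>\<close>

lemma frechet_derivative_bilinear:
  assumes "bounded_bilinear B" "f differentiable (at x)" "g differentiable (at x)"
  shows "((\<lambda>x. B (f x) (g x)) has_derivative
           (\<lambda>h. B (f x) (frechet_derivative g (at x) h) + B (frechet_derivative f (at x) h) (g x))) (at x)"
  using bounded_bilinear.FDERIV[OF assms(1) assms(2,3)[unfolded frechet_derivative_works]] .

lemma Ck_SucD: "Ck (Suc k) f \<Longrightarrow> Ck k f"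
proof (induction k arbitrary: f)
  case 0
  then show ?case
    by (auto intro!: continuous_at_imp_continuous_on differentiable_imp_continuous_within)
next
  case (Suc k)
  then show ?case by (metis Ck.simps(2))
qed

lemma Ck_const: "Ck k (\<lambda>x. c)"
  by (induction k arbitrary: c) auto

lemma Ck_add:
  assumes "Ck k f" "Ck k g"
  shows "Ck k (\<lambda>x. f x + g x)"
  using assms
proof (induction k arbitrary: f g)
  case 0
  then show ?case by (auto intro: continuous_intros)
next
  case (Suc k)
  have "frechet_derivative (\<lambda>x. f x + g x) (at x) =
          (\<lambda>h. frechet_derivative f (at x) h + frechet_derivative g (at x) h)" for x
    using Suc.prems by (intro frechet_derivative_at[symmetric] has_derivative_add)
      (auto simp: frechet_derivative_works)
  with Suc show ?case by auto
qed

lemma Ck_sum: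
  assumes "\<And>i. i \<in> I \<Longrightarrow> Ck k (f i)"
  shows "Ck k (\<lambda>x. \<Sum>i\<in>I. f i x)"
  using assms by (induction I rule: infinite_finite_induct) (auto simp: Ck_const Ck_add)

lemma Ck_bounded_linear:
  assumes "bounded_linear L" "Ck k f"
  shows "Ck k (\<lambda>x. L (f x))"
  using assms(2)
proof (induction k arbitrary: f)
  case 0
  then show ?case using assms(1) by (auto intro: bounded_linear.continuous_on)
next
  case (Suc k)
  have D: "((\<lambda>x. L (f x)) has_derivative (\<lambda>h. L (frechet_derivative f (at x) h))) (at x)" for x
    using Suc.prems assms(1) bounded_linear.has_derivative frechet_derivative_works by fastforce
  have "frechet_derivative (\<lambda>x. L (f x)) (at x) = (\<lambda>h. L (frechet_derivative f (at x) h))" for x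
    using frechet_derivative_at[OF D] by simp
  with Suc D show ?case by (auto simp: differentiable_def)
qed

lemma Ck_bounded_bilinear:
  assumes "bounded_bilinear B" "Ck k f" "Ck k g"
  shows "Ck k (\<lambda>x. B (f x) (g x))"
  using assms(2,3)
proof (induction k arbitrary: f g)
  case 0
  then show ?case using assms(1) by (auto intro: bounded_bilinear.continuous_on)
next
  case (Suc k)
  have D: "((\<lambda>x. B (f x) (g x)) has_derivative (\<lambda>h. B (f x) (frechet_derivative g (at x) h)
             + B (frechet_derivative f (at x) h) (g x))) (at x)" for x
    using Suc.prems assms(1) by (intro frechet_derivative_bilinear) auto
  have "frechet_derivative (\<lambda>x. B (f x) (g x)) (at x) = (\<lambda>h. B (f x) (frechet_derivative g (at x) h)
             + B (frechet_derivative f (at x) h) (g x))" for x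
    using frechet_derivative_at[OF D] by simp
  moreover have "Ck k f" "Ck k g" using Suc.prems by (blast dest: Ck_SucD)+
  moreover have "(\<lambda>x. B (f x) (g x)) differentiable (at x)" for x
    using D by (rule differentiableI)
  ultimately show ?case using Suc by (auto intro!: Ck_add)
qed

lemma Ck_grad:
  assumes "Ck (Suc k) u"
  shows "Ck k (grad u)"
proof -
  have "grad u = (\<lambda>x. \<Sum>i\<in>UNIV. frechet_derivative u (at x) (axis i 1) *\<^sub>R axis i 1)"
    by (auto simp: grad_def fun_eq_iff vec_eq_iff axis_def if_distrib cong: if_cong)
  moreover have "Ck k (\<lambda>x. frechet_derivative u (at x) (axis i 1))" for i
    using assms by (auto simp: axis_in_Basis_iff)
  then have "Ck k (\<lambda>x. frechet_derivative u (at x) (axis i 1) *\<^sub>R (axis i 1 :: real^'a))" for i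
    by (rule Ck_bounded_linear[OF bounded_linear_scaleR_left])
  ultimately show ?thesis by (simp add: Ck_sum)
qed

lemma has_derivative_grad:
  assumes "u differentiable (at x)"
  shows "(u has_derivative (\<lambda>v. grad u x \<bullet> v)) (at x)"
proof -
  have "grad u x \<bullet> v = frechet_derivative u (at x) v" for v
  proof -
    have "frechet_derivative u (at x) v = frechet_derivative u (at x) (\<Sum>i\<in>UNIV. v$i *\<^sub>R axis i 1)"
      by (simp add: basis_expansion flip: scalar_mult_eq_scaleR)
    also have "\<dots> = (\<Sum>i\<in>UNIV. v$i * frechet_derivative u (at x) (axis i 1))"
      using linear_frechet_derivative[OF assms] by (simp add: linear_sum linear_cmul)
    finally show ?thesis by (simp add: grad_def inner_vec_def mult.commute)
  qed
  then show ?thesis using assms by (metis (no_types, lifting) ext frechet_derivative_works)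
qed

lemma grad_inner_eqI:
  assumes "(u has_derivative u') (at x)"
  shows "grad u x \<bullet> v = u' v"
  using assms has_derivative_grad has_derivative_unique differentiable_def by metis

lemma grad_along_curve:
  assumes "(y has_vector_derivative v) (at s)" "u differentiable (at (y s))"
  shows "((\<lambda>s. u (y s)) has_vector_derivative (grad u (y s) \<bullet> v)) (at s)"
  using vector_derivative_diff_chain_within[of y v s UNIV u "\<lambda>v. grad u (y s) \<bullet> v"]
    has_derivative_at_withinI[OF has_derivative_grad[OF assms(2)]] assms(1)
  by (simp add: o_def)

section \<open>Symmetry of the second derivative\<close>

text \<open>
  The mean value theorem applied to \<open>s \<mapsto> u (x + s v + t w) - u (x + s v)\<close> turns the second difference
  into a difference of gradients, to which the derivative \<open>H\<close> of the gradient applies. That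
  gives a remainder \<open>o(t\<^sup>2)\<close>, stated here with an arbitrary \<open>e\<close> and its constants explicit.
\<close>

lemma second_difference_approx:
  assumes du: "\<And>x. u differentiable (at x)"
    and H: "(grad u has_derivative H) (at x)" and "e > 0"
  shows "\<forall>\<^sub>F t in at_right 0.
    \<bar>(u (x + t *\<^sub>R v + t *\<^sub>R w) - u (x + t *\<^sub>R v) - u (x + t *\<^sub>R w) + u x) - t\<^sup>2 * (H w \<bullet> v)\<bar>
      \<le> t\<^sup>2 * (2 * e * (norm v + norm w) * norm v)"
proof -
  obtain d where "d > 0" and d: "\<And>z. norm (z - x) < d \<Longrightarrow>
      norm (grad u z - grad u x - H (z - x)) \<le> e * norm (z - x)"
    using has_derivative_at_alt[THEN iffD1, OF H] \<open>e > 0\<close> by blast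
  have lin: "linear H" using H has_derivative_linear by blast
  have est: "\<bar>(u (x + t *\<^sub>R v + t *\<^sub>R w) - u (x + t *\<^sub>R v) - u (x + t *\<^sub>R w) + u x) - t\<^sup>2 * (H w \<bullet> v)\<bar>
      \<le> t\<^sup>2 * (2 * e * (norm v + norm w) * norm v)"
    if "0 < t" "t * (norm v + norm w) < d" for t
  proof -
    define \<phi> where "\<phi> s = u (x + s *\<^sub>R v + t *\<^sub>R w) - u (x + s *\<^sub>R v)" for s
    have D: "(\<phi> has_derivative (\<lambda>h. h * ((grad u (x + s *\<^sub>R v + t *\<^sub>R w) - grad u (x + s *\<^sub>R v)) \<bullet> v)))
        (at s within {0..t})" for s
    proof -
      have *: "((\<lambda>s. u (x + s *\<^sub>R v + z)) has_vector_derivative grad u (x + s *\<^sub>R v + z) \<bullet> v) (at s)" for z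
        by (rule grad_along_curve) (auto intro!: derivative_eq_intros du)
      have "(\<phi> has_vector_derivative
              grad u (x + s *\<^sub>R v + t *\<^sub>R w) \<bullet> v - grad u (x + s *\<^sub>R v) \<bullet> v) (at s)"
        unfolding \<phi>_def
        by (rule has_vector_derivative_diff[OF *[of "t *\<^sub>R w"] *[of 0, unfolded add_0_right]])
      then show ?thesis
        by (simp add: has_vector_derivative_def inner_diff_left has_derivative_at_withinI)
    qed
    obtain \<xi> where \<xi>: "\<xi> \<in> {0<..<t}"
      and eq: "\<phi> t - \<phi> 0 = t * ((grad u (x + \<xi> *\<^sub>R v + t *\<^sub>R w) - grad u (x + \<xi> *\<^sub>R v)) \<bullet> v)"
      using mvt_simple[OF \<open>0 < t\<close> D] by auto
    define R where "R z = grad u (x + z) - grad u x - H z" for z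
    have R: "norm (R z) \<le> e * (t * (norm v + norm w))" if "norm z \<le> t * (norm v + norm w)" for z
    proof -
      have "norm (R z) \<le> e * norm z"
        using d[of "x + z"] that \<open>t * (norm v + norm w) < d\<close> by (simp add: R_def)
      also have "\<dots> \<le> e * (t * (norm v + norm w))"
        using that \<open>e > 0\<close> by simp
      finally show ?thesis .
    qed
    have le: "norm (\<xi> *\<^sub>R v) \<le> t * norm v" "norm (t *\<^sub>R w) = t * norm w"
      using \<xi> \<open>0 < t\<close> by (auto intro: mult_right_mono)
    have n1: "norm (\<xi> *\<^sub>R v + t *\<^sub>R w) \<le> t * (norm v + norm w)"
      using norm_triangle_ineq[of "\<xi> *\<^sub>R v" "t *\<^sub>R w"] le unfolding distrib_left by linarith
    have n2: "norm (\<xi> *\<^sub>R v) \<le> t * (norm v + norm w)"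
      using le \<open>0 < t\<close> by (simp add: algebra_simps add_increasing2)
    have "grad u (x + \<xi> *\<^sub>R v + t *\<^sub>R w) - grad u (x + \<xi> *\<^sub>R v)
        = t *\<^sub>R H w + (R (\<xi> *\<^sub>R v + t *\<^sub>R w) - R (\<xi> *\<^sub>R v))"
      by (simp add: R_def linear_add[OF lin] linear_cmul[OF lin] algebra_simps)
    then have "(u (x + t *\<^sub>R v + t *\<^sub>R w) - u (x + t *\<^sub>R v) - u (x + t *\<^sub>R w) + u x) - t\<^sup>2 * (H w \<bullet> v)
        = t * ((R (\<xi> *\<^sub>R v + t *\<^sub>R w) - R (\<xi> *\<^sub>R v)) \<bullet> v)"
      using eq by (simp add: \<phi>_def inner_add_left right_diff_distrib distrib_left power2_eq_square)
    also have "\<bar>\<dots>\<bar> \<le> t * ((2 * (e * (t * (norm v + norm w)))) * norm v)"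
    proof -
      have "norm (R (\<xi> *\<^sub>R v + t *\<^sub>R w) - R (\<xi> *\<^sub>R v)) \<le> 2 * (e * (t * (norm v + norm w)))"
        using norm_triangle_ineq4[of "R (\<xi> *\<^sub>R v + t *\<^sub>R w)" "R (\<xi> *\<^sub>R v)"] R[OF n1] R[OF n2] by linarith
      then have "\<bar>(R (\<xi> *\<^sub>R v + t *\<^sub>R w) - R (\<xi> *\<^sub>R v)) \<bullet> v\<bar> \<le> 2 * (e * (t * (norm v + norm w))) * norm v"
        by (intro order_trans[OF Cauchy_Schwarz_ineq2] mult_right_mono) auto
      then show ?thesis using \<open>0 < t\<close> by (simp add: abs_mult)
    qed
    finally show ?thesis by (simp add: power2_eq_square algebra_simps)
  qed
  define b where "b = d / (norm v + norm w + 1)"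
  have "b > 0" using \<open>d > 0\<close> by (simp add: b_def add_nonneg_pos)
  moreover have "t * (norm v + norm w) < d" if "0 < t" "t < b" for t
  proof -
    have "t * (norm v + norm w) \<le> t * (norm v + norm w + 1)" using that by simp
    also have "\<dots> < d" using that by (simp add: b_def pos_less_divide_eq add_nonneg_pos)
    finally show ?thesis .
  qed
  ultimately show ?thesis using est by (auto simp: eventually_at_right_field)
qed

text \<open>
  The second difference is symmetric in \<open>v\<close> and \<open>w\<close>, while \<open>second_difference_approx\<close> approximates it by
  \<open>t\<^sup>2 (H w \<bullet> v)\<close> as well as by \<open>t\<^sup>2 (H v \<bullet> w)\<close>.
\<close>

theorem second_derivative_symmetric:
  assumes du: "\<And>x. u differentiable (at x)" and H: "(grad u has_derivative H) (at x)"
  shows "H v \<bullet> w = H w \<bullet> v"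
proof -
  define c where "c = 2 * (norm v + norm w) * norm v + 2 * (norm w + norm v) * norm w"
  have "c \<ge> 0" by (simp add: c_def)
  have bound: "\<bar>H w \<bullet> v - H v \<bullet> w\<bar> \<le> e * c" if "e > 0" for e
  proof -
    have "\<forall>\<^sub>F t in at_right (0::real). \<bar>H w \<bullet> v - H v \<bullet> w\<bar> \<le> e * c"
      using second_difference_approx[OF du H that, of v w] second_difference_approx[OF du H that, of w v]
        eventually_at_right_less[of 0]
    proof eventually_elim
      case (elim t)
      then have "\<bar>t\<^sup>2 * (H w \<bullet> v) - t\<^sup>2 * (H v \<bullet> w)\<bar> \<le>
          t\<^sup>2 * (2 * e * (norm v + norm w) * norm v) + t\<^sup>2 * (2 * e * (norm w + norm v) * norm w)"
        by (simp add: add.commute add.left_commute)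
      moreover have "\<bar>t\<^sup>2 * (H w \<bullet> v) - t\<^sup>2 * (H v \<bullet> w)\<bar> = t\<^sup>2 * \<bar>H w \<bullet> v - H v \<bullet> w\<bar>"
        by (simp add: abs_mult flip: right_diff_distrib)
      ultimately have "t\<^sup>2 * \<bar>H w \<bullet> v - H v \<bullet> w\<bar> \<le> t\<^sup>2 * (e * c)"
        by (simp add: c_def algebra_simps)
      then show ?case using elim by simp
    qed
    then show ?thesis by (simp add: eventually_const_iff)
  qed
  have "\<bar>H w \<bullet> v - H v \<bullet> w\<bar> \<le> 0"
  proof (rule field_le_epsilon)
    fix e :: real assume "e > 0"
    have "\<bar>H w \<bullet> v - H v \<bullet> w\<bar> \<le> (e / (c + 1)) * c"
      using bound[of "e / (c + 1)"] \<open>e > 0\<close> \<open>c \<ge> 0\<close> by simp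
    also have "\<dots> \<le> e" using \<open>c \<ge> 0\<close> \<open>e > 0\<close> by (simp add: field_simps)
    finally show "\<bar>H w \<bullet> v - H v \<bullet> w\<bar> \<le> 0 + e" by simp
  qed
  then show ?thesis by simp
qed

section \<open>Second-order derivatives along vector fields\<close>

text \<open>
  A vector field acts on functions as a derivation. Iterating this action puts the matrix entries
  \<open>\<nabla>(\<nabla>u \<bullet> f) \<bullet> g\<close>, the Lie bracket and condition (2) in one notation.
\<close>

definition lie_deriv :: "(real^'n \<Rightarrow> real^'n) \<Rightarrow> (real^'n \<Rightarrow> real) \<Rightarrow> real^'n \<Rightarrow> real" where
  "lie_deriv f u x = grad u x \<bullet> f x"

lemma Ck_lie_deriv: "Ck (Suc k) u \<Longrightarrow> Ck k f \<Longrightarrow> Ck k (lie_deriv f u)"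
  unfolding lie_deriv_def[abs_def]
  by (intro Ck_bounded_bilinear[OF bounded_bilinear_inner] Ck_grad)

text \<open>
  The Hessian terms of the two iterated derivatives cancel by symmetry; what is left are the terms in
  which the fields themselves are differentiated.
\<close>

lemma lie_deriv_commutator:
  fixes f g :: "real^'n \<Rightarrow> real^'n"
  assumes "Ck 2 u" "f differentiable (at x)" "g differentiable (at x)"
  shows "lie_deriv f (lie_deriv g u) x - lie_deriv g (lie_deriv f u) x = lie_bracket f g x \<bullet> grad u x"
proof -
  have gr: "Ck (Suc 0) (grad u)" and du: "\<And>x. u differentiable (at x)"
    using assms(1) Ck_grad[of "Suc 0" u] by (auto simp: numeral_2_eq_2)
  define H where "H = frechet_derivative (grad u) (at x)"
  have H: "(grad u has_derivative H) (at x)"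
    using gr by (simp add: H_def flip: frechet_derivative_works)
  have *: "grad (\<lambda>y. grad u y \<bullet> k y) x \<bullet> v = grad u x \<bullet> (jacobian k (at x) *v v) + H v \<bullet> k x"
    if "k differentiable (at x)" for k :: "real^'n \<Rightarrow> real^'n" and v
    using that bounded_bilinear.FDERIV[OF bounded_bilinear_inner H]
    by (intro grad_inner_eqI) (auto simp: jacobian_works)
  show ?thesis
    using second_derivative_symmetric[OF du H, of "f x" "g x"]
    unfolding lie_deriv_def[abs_def] *[OF assms(2)] *[OF assms(3)]
    by (simp add: lie_bracket_def inner_diff_right inner_commute)
qed

lemma lie_deriv_add_scaled:
  assumes "u differentiable (at x)" "v differentiable (at x)"
  shows "lie_deriv f (\<lambda>y. u y + c * v y) x = lie_deriv f u x + c * lie_deriv f v x"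
  unfolding lie_deriv_def
  by (rule grad_inner_eqI) (intro has_derivative_add has_derivative_mult_right has_derivative_grad assms)

lemma second_lie_deriv_add_scaled:
  fixes c :: real
  assumes "lie_deriv f u differentiable (at x)" "lie_deriv g u differentiable (at x)"
  defines "h \<equiv> \<lambda>y. f y + c *\<^sub>R g y"
  shows "lie_deriv h (lie_deriv h u) x = lie_deriv f (lie_deriv f u) x
     + c * (lie_deriv f (lie_deriv g u) x + lie_deriv g (lie_deriv f u) x)
     + c\<^sup>2 * lie_deriv g (lie_deriv g u) x"
proof -
  have "lie_deriv h u = (\<lambda>y. lie_deriv f u y + c * lie_deriv g u y)"
    by (simp add: h_def lie_deriv_def fun_eq_iff inner_add_right)
  moreover have "lie_deriv h w x = lie_deriv f w x + c * lie_deriv g w x" for w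
    by (simp add: h_def lie_deriv_def inner_add_right)
  ultimately show ?thesis
    by (simp add: lie_deriv_add_scaled[OF assms(1,2)] power2_eq_square algebra_simps)
qed

text \<open>
  First-order optimality at \<open>e = 0\<close>. The restriction to small \<open>e\<close> matches the bound on the controls.
\<close>

lemma linear_coefficient_eq_0:
  fixes p q :: real
  assumes "\<And>e. \<bar>e\<bar> \<le> 1 \<Longrightarrow> 0 \<le> e * p + e\<^sup>2 * q"
  shows "p = 0"
proof (rule ccontr)
  assume "p \<noteq> 0"
  \<comment> \<open>A step against the sign of \<open>p\<close>, short enough for the linear term to beat the quadratic one.\<close>
  define m where "m = min 1 (\<bar>p\<bar> / (2 * (\<bar>q\<bar> + 1)))"
  have "m \<le> (\<bar>p\<bar> / 2) / (\<bar>q\<bar> + 1)" by (simp add: m_def)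
  then have m: "m * (\<bar>q\<bar> + 1) \<le> \<bar>p\<bar> / 2"
    by (subst (asm) pos_le_divide_eq) auto
  have m: "0 < m" "m \<le> 1" "m * (\<bar>q\<bar> + 1) \<le> \<bar>p\<bar> / 2"
    using \<open>p \<noteq> 0\<close> m by (auto simp: m_def add_nonneg_pos)
  have "0 \<le> (- sgn p * m) * p + (- sgn p * m)\<^sup>2 * q"
    using m \<open>p \<noteq> 0\<close> by (intro assms) (auto simp: abs_mult)
  also have "\<dots> = m * (m * q - \<bar>p\<bar>)"
    using \<open>p \<noteq> 0\<close> by (auto simp: sgn_if power2_eq_square algebra_simps)
  finally have "\<bar>p\<bar> \<le> m * q" using m by (simp add: zero_le_mult_iff)
  also have "\<dots> \<le> m * (\<bar>q\<bar> + 1)" using m by (intro mult_left_mono) auto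
  finally show False using m \<open>p \<noteq> 0\<close> by simp
qed

section \<open>The matrix \<open>K\<close>\<close>

lemma quadratic_form_block_mat:
  fixes S :: "real^'m^'m"
  defines "K \<equiv> block_mat (sym_part S) (transpose S) S (sym_part S)"
  shows "(\<chi> p. case p of Inl i \<Rightarrow> v $ i | Inr i \<Rightarrow> w $ i) \<bullet>
           (K *v (\<chi> p. case p of Inl i \<Rightarrow> v $ i | Inr i \<Rightarrow> w $ i))
         = v \<bullet> (sym_part S *v v) + v \<bullet> (transpose S *v w) + w \<bullet> (S *v v) + w \<bullet> (sym_part S *v w)"
proof -
  have split: "(\<Sum>p\<in>UNIV. f p) = (\<Sum>i\<in>UNIV. f (Inl i)) + (\<Sum>i\<in>UNIV. f (Inr i))"
    for f :: "'m + 'm \<Rightarrow> real"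
    by (simp add: UNIV_Plus_UNIV[symmetric] sum.Plus del: UNIV_Plus_UNIV)
  show ?thesis
    by (simp add: K_def block_mat_def inner_vec_def matrix_vector_mult_def split
        distrib_left sum.distrib)
qed

text \<open>
  With \<open>S\<close> in the off-diagonal blocks and its symmetric part on the diagonal, the quadratic form at
  \<open>(v, w)\<close> is \<open>v \<bullet> S v + w \<bullet> S w + 2 (w \<bullet> S v)\<close>. It vanishes at \<open>(v, -v)\<close>, so its first variation there
  in the direction \<open>(0, z)\<close>, which is the antisymmetric part of \<open>S\<close> paired with \<open>v\<close> and \<open>z\<close>, has to be zero.
\<close>

lemma pos_semidef_block_imp:
  fixes S :: "real^'m^'m"
  assumes "pos_semidef (block_mat (sym_part S) (transpose S) S (sym_part S))"
  shows "transpose S = S" "0 \<le> v \<bullet> (S *v v)"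
proof -
  have tr: "v \<bullet> (transpose S *v w) = w \<bullet> (S *v v)" for v w
    by (metis dot_lmul_matrix inner_commute transpose_matrix_vector)
  have sp: "v \<bullet> (sym_part S *v v) = v \<bullet> (S *v v)" for v
    using tr[of v v]
    by (simp add: sym_part_def matrix_vector_mult_add_rdistrib inner_add_right
        scaleR_matrix_vector_assoc[symmetric])
  have form: "0 \<le> v \<bullet> (S *v v) + 2 * (w \<bullet> (S *v v)) + w \<bullet> (S *v w)" for v w
    using assms quadratic_form_block_mat[where S = S and v = v and w = w]
    unfolding pos_semidef_def tr sp by (smt (verit, best))
  show "0 \<le> v \<bullet> (S *v v)" using form[of v v] by simp
  have sym: "z \<bullet> (S *v v) = v \<bullet> (S *v z)" for v z
  proof -
    have "0 \<le> e * (z \<bullet> (S *v v) - v \<bullet> (S *v z)) + e\<^sup>2 * (z \<bullet> (S *v z))" for e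
      using form[of v "- v + e *\<^sub>R z"]
      by (simp add: matrix_vector_right_distrib matrix_vector_mult_diff_distrib inner_add_left inner_add_right
          inner_diff_left inner_diff_right matrix_vector_mult_scaleR power2_eq_square algebra_simps)
    from linear_coefficient_eq_0[OF this] show ?thesis by simp
  qed
  show "transpose S = S"
    using sym[of "axis i 1" "axis j 1" for i j]
    by (simp add: vec_eq_iff transpose_def matrix_vector_mult_basis inner_axis' column_def)
qed

section \<open>Piecewise constant controls\<close>

lemma locally_constant_interior:
  fixes a :: "real \<Rightarrow> 'b"
  assumes I: "is_interval I" "bounded I" "a constant_on I" "s \<in> I" "s \<noteq> Inf I" "s \<noteq> Sup I"
  shows "\<forall>\<^sub>F t in nhds s. a t = a s"
proof -
  have bdd: "bdd_below I" "bdd_above I"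
    using I(2) bounded_imp_bdd_below bounded_imp_bdd_above by auto
  then have "Inf I < s" "s < Sup I"
    using I cInf_lower[of s I] cSup_upper[of s I] by auto
  then obtain p q where pq: "p \<in> I" "p < s" "q \<in> I" "s < q"
    using I(4) bdd cInf_less_iff[of I s] less_cSup_iff[of I s] by auto
  have "a t = a s" if "\<bar>t - s\<bar> < min (s - p) (q - s)" for t
  proof -
    have "t \<in> I" using that pq by (intro mem_is_interval_1_I[OF I(1) pq(1) pq(3)]) auto
    then show ?thesis using I(3,4) by (auto simp: constant_on_def)
  qed
  moreover have "0 < min (s - p) (q - s)" using pq by simp
  ultimately show ?thesis
    unfolding eventually_nhds_metric dist_real_def by (intro exI[of _ "min (s - p) (q - s)"] conjI allI impI)
qed

text \<open>
  A piece of the partition can fail to be a neighbourhood of one of its points only at its two ends, so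
  the infima and suprema of the pieces are the only possible jumps. For the empty piece they are
  arbitrary numbers, which does no harm.
\<close>

lemma admissible_control_locally_constant:
  assumes "admissible_control a" "T \<ge> 0"
  shows "\<exists>D. finite D \<and> (\<forall>s\<in>{0..T} - D. \<forall>\<^sub>F t in nhds s. a t = a s)"
proof -
  from assms have "\<exists>P. finite P \<and> \<Union>P = {0..T} \<and> (\<forall>I\<in>P. is_interval I \<and> a constant_on I)"
    by (simp add: admissible_control_def)
  then obtain P where P: "finite P" "\<Union>P = {0..T}"
    "\<And>I. I \<in> P \<Longrightarrow> is_interval I \<and> a constant_on I"
    by blast
  show ?thesis
  proof (intro exI[of _ "Inf ` P \<union> Sup ` P"] conjI ballI)
    show "finite (Inf ` P \<union> Sup ` P)" using P by simp
    fix s assume s: "s \<in> {0..T} - (Inf ` P \<union> Sup ` P)"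
    then have "s \<in> \<Union>P" unfolding P(2) by simp
    then obtain I where I: "I \<in> P" "s \<in> I" by blast
    have "I \<subseteq> {0..T}" using I(1) P(2) by blast
    then have bounded: "bounded I" by (rule bounded_subset[OF bounded_closed_interval])
    have ends: "s \<noteq> Inf I" "s \<noteq> Sup I" using s I(1) by blast+
    have interval: "is_interval I" "a constant_on I" using P(3)[OF I(1)] by simp_all
    show "\<forall>\<^sub>F t in nhds s. a t = a s"
      by (rule locally_constant_interior[OF interval(1) bounded interval(2) I(2) ends])
  qed
qed

lemma continuous_at_locally_constant: "\<forall>\<^sub>F t in nhds s. a t = a s \<Longrightarrow> isCont a s"
  using isCont_cong[of a "\<lambda>_. a s" s] by simp

lemma integrable_bounded_continuous_off_finite:
  fixes f :: "real \<Rightarrow> 'b::euclidean_space"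
  assumes "finite D" "\<And>s. s \<in> {a..b} - D \<Longrightarrow> isCont f s" "\<And>s. s \<in> {a..b} \<Longrightarrow> norm (f s) \<le> M"
  shows "f integrable_on {a..b}"
proof -
  have neg: "negligible ({a..b} \<inter> D)" using assms(1) by (simp add: negligible_finite)
  have S: "{a..b} - D \<in> sets lebesgue"
    using assms(1) by (intro sets.Diff) (auto intro: negligible_imp_sets negligible_finite)
  have "f integrable_on ({a..b} - D)"
  proof (rule measurable_bounded_by_integrable_imp_integrable[where g = "\<lambda>_. M"])
    show "f \<in> borel_measurable (lebesgue_on ({a..b} - D))"
      using S assms(2) by (intro continuous_imp_measurable_on_sets_lebesgue continuous_at_imp_continuous_on) auto
    have "(\<lambda>_::real. M) integrable_on {a..b}" by (simp add: integrable_const_ivl)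
    then show "(\<lambda>_::real. M) integrable_on ({a..b} - D)"
      by (rule integrable_spike_set) (auto intro: negligible_subset[OF neg])
  qed (use assms(3) S in auto)
  then show ?thesis
    by (rule integrable_spike_set) (auto intro: negligible_subset[OF neg])
qed

lemma integral_has_vector_derivative_interior:
  fixes f :: "real \<Rightarrow> 'b::banach"
  assumes "f integrable_on {a..b}" "s \<in> {a<..<b}" "isCont f s"
  shows "((\<lambda>u. integral {a..u} f) has_vector_derivative f s) (at s)"
proof -
  have "((\<lambda>u. integral {a..u} f) has_vector_derivative f s) (at s within {a..b})"
    using integral_has_vector_derivative_continuous_at[of f a b s "{}"] assms
    by (auto intro: continuous_at_imp_continuous_at_within)
  moreover have "at s within {a..b} = at s"
    using assms(2) by (intro at_within_interior) auto
  ultimately show ?thesis by simp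
qed

text \<open>
  The mean value inequality for curves with finitely many corners, as produced by the jumps of a control.
\<close>

lemma norm_increment_le:
  fixes f :: "real \<Rightarrow> 'b::banach"
  assumes "finite D" "a \<le> b" "continuous_on {a..b} f" "0 \<le> B"
    and der: "\<And>s. s \<in> {a<..<b} - D \<Longrightarrow> (f has_vector_derivative f' s) (at s)"
    and bound: "\<And>s. s \<in> {a<..<b} - D \<Longrightarrow> norm (f' s) \<le> B"
  shows "norm (f b - f a) \<le> B * (b - a)"
proof -
  define g where "g s = (if s \<in> {a<..<b} - D then f' s else 0)" for s
  have "(g has_integral (f b - f a)) (cbox a b)"
    using fundamental_theorem_of_calculus_interior_strong[of "D" a b f g] assms
    by (simp add: g_def)
  then have "norm (f b - f a) \<le> B * measure lborel (cbox a b)"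
    by (rule has_integral_bound[OF \<open>0 \<le> B\<close>]) (use bound \<open>0 \<le> B\<close> in \<open>auto simp: g_def\<close>)
  then show ?thesis using \<open>a \<le> b\<close> by simp
qed

section \<open>Trajectories\<close>

text \<open>
  A curve driven by the fields \<open>X k\<close> without drift, with coefficients \<open>b\<close> that may jump on \<open>D\<close>. Only
  what the estimates need of a control is kept: bounded components and continuity off a finite set.
\<close>

locale driven_curve =
  fixes X :: "'k::finite \<Rightarrow> real^'n \<Rightarrow> real^'n"
    and b :: "real \<Rightarrow> real^'k" and D :: "real set" and T :: real
    and y :: "real \<Rightarrow> real^'n"
  assumes T: "0 \<le> T" and finite_D: "finite D"
    and continuous_y: "continuous_on {0..T} y"
    and b_le_1: "s \<in> {0..T} \<Longrightarrow> \<bar>b s $ k\<bar> \<le> 1"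
    and b_continuous: "s \<in> {0..T} - D \<Longrightarrow> isCont b s"
    and y': "s \<in> {0<..<T} - D \<Longrightarrow>
        (y has_vector_derivative (\<Sum>k\<in>UNIV. b s $ k *\<^sub>R X k (y s))) (at s)"
begin

definition B :: "real \<Rightarrow> real^'k" where
  "B s = integral {0..s} b"

lemma b_integrable: "b integrable_on {0..T}"
proof (rule integrable_bounded_continuous_off_finite[OF finite_D b_continuous])
  fix s assume "s \<in> {0..T}"
  then have "(\<Sum>k\<in>UNIV. \<bar>b s $ k\<bar>) \<le> (\<Sum>k\<in>(UNIV::'k set). 1)" by (intro sum_mono b_le_1)
  then show "norm (b s) \<le> real CARD('k)"
    using norm_le_l1_cart[of "b s"] by simp
qed auto

lemma B_0: "B 0 = 0"
  by (simp add: B_def)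

lemma continuous_B: "continuous_on {0..T} B"
  unfolding B_def using b_integrable by (rule indefinite_integral_continuous_1)

lemma B': "s \<in> {0<..<T} - D \<Longrightarrow> (B has_vector_derivative b s) (at s)"
  unfolding B_def by (rule integral_has_vector_derivative_interior[OF b_integrable]) (auto intro: b_continuous)

text \<open>
  As long as the curve is in the ball of radius \<open>\<delta>\<close> its speed is at most \<open>M\<close>. At a first time on the
  boundary of the ball it would have travelled farther than that speed permits.
\<close>

lemma stays_close:
  assumes M: "0 \<le> M" "\<And>z. z \<in> cball c \<delta> \<Longrightarrow> (\<Sum>k\<in>UNIV. norm (X k z)) \<le> M"
    and small: "norm (y 0 - c) + M * T < \<delta>" and s: "s \<in> {0..T}"
  shows "norm (y s - y 0) \<le> M * s" "norm (y s - c) < \<delta>"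
proof -
  \<comment> \<open>The estimate holds up to any time before which the ball has not been left.\<close>
  have travel: "norm (y t - y 0) \<le> M * t" "norm (y t - c) < \<delta>"
    if t: "t \<in> {0..T}" and inside: "\<And>s. s \<in> {0<..<t} \<Longrightarrow> norm (y s - c) \<le> \<delta>" for t
  proof -
    have "norm (y t - y 0) \<le> M * (t - 0)"
    proof (rule norm_increment_le[OF finite_D])
      show "continuous_on {0..t} y" by (rule continuous_on_subset[OF continuous_y]) (use t in auto)
      fix s assume s: "s \<in> {0<..<t} - D"
      then show "(y has_vector_derivative (\<Sum>k\<in>UNIV. b s $ k *\<^sub>R X k (y s))) (at s)"
        using t by (intro y') auto
      have "norm (\<Sum>k\<in>UNIV. b s $ k *\<^sub>R X k (y s)) \<le> (\<Sum>k\<in>UNIV. norm (X k (y s)))"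
        using s t by (intro sum_norm_le) (auto intro!: mult_left_le_one_le b_le_1)
      also have "\<dots> \<le> M"
        using s inside[of s] by (intro M) (auto simp: dist_norm norm_minus_commute)
      finally show "norm (\<Sum>k\<in>UNIV. b s $ k *\<^sub>R X k (y s)) \<le> M" .
    qed (use M t in auto)
    then show *: "norm (y t - y 0) \<le> M * t" by simp
    have "M * t \<le> M * T" using t M by (intro mult_left_mono) auto
    then show "norm (y t - c) < \<delta>"
      using * small norm_triangle_ineq[of "y t - y 0" "y 0 - c"] by simp
  qed
  define E where "E = {t \<in> {0..T}. \<delta> \<le> norm (y t - c)}"
  have "E = {}"
  proof (rule ccontr)
    assume "E \<noteq> {}"
    have "compact E"
    proof -
      have "closed E" unfolding E_def
        by (intro continuous_on_closed_Collect_le continuous_intros continuous_y closed_atLeastAtMost)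
      moreover have "E = {0..T} \<inter> E" by (auto simp: E_def)
      ultimately show ?thesis by (metis compact_Icc compact_Int_closed)
    qed
    then obtain t where t: "t \<in> E" "\<And>s. s \<in> E \<Longrightarrow> t \<le> s"
      using compact_attains_inf[OF _ \<open>E \<noteq> {}\<close>] by auto
    have "norm (y s - c) \<le> \<delta>" if "s \<in> {0<..<t}" for s
      using t(2)[of s] t(1) that by (cases "norm (y s - c) \<le> \<delta>") (auto simp: E_def)
    then have "norm (y t - c) < \<delta>" using t(1) by (intro travel) (auto simp: E_def)
    then show False using t(1) by (simp add: E_def)
  qed
  then have "norm (y r - c) \<le> \<delta>" if "r \<in> {0..T}" for r using that by (force simp: E_def)
  then show "norm (y s - y 0) \<le> M * s" "norm (y s - c) < \<delta>"
    using s by (auto intro!: travel)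
qed

end

lemma differentiable_local_bound:
  assumes "f differentiable (at c)"
  shows "\<exists>L\<ge>0. \<forall>\<^sub>F x in nhds c. norm (f x - f c) \<le> L * norm (x - c)"
proof -
  from assms obtain f' where f': "(f has_derivative f') (at c)" by (auto simp: differentiable_def)
  obtain K where K: "K > 0" "\<And>h. norm (f' h) \<le> norm h * K"
    using bounded_linear.pos_bounded[OF has_derivative_bounded_linear[OF f']] by auto
  obtain d where d: "d > 0" "\<And>x. norm (x - c) < d \<Longrightarrow> norm (f x - f c - f' (x - c)) \<le> 1 * norm (x - c)"
    using has_derivative_at_alt[THEN iffD1, OF f'] zero_less_one by blast
  have "norm (f x - f c) \<le> (K + 1) * norm (x - c)" if "norm (x - c) < d" for x
    using d(2)[OF that] K(2)[of "x - c"] norm_triangle_ineq[of "f x - f c - f' (x - c)" "f' (x - c)"]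
    by (simp add: algebra_simps)
  then have "\<forall>\<^sub>F x in nhds c. norm (f x - f c) \<le> (K + 1) * norm (x - c)"
    using d(1) by (auto simp: eventually_nhds_metric dist_norm)
  then show ?thesis using K(1) by (intro exI[of _ "K + 1"]) auto
qed

text \<open>
  Differentiability at a point is all the regularity that the error terms require: each of them is a
  function that vanishes at the base point, evaluated along the curve.
\<close>

lemma differentiable_family_local_bound:
  fixes f :: "'i::finite \<Rightarrow> 'a::real_normed_vector \<Rightarrow> 'b::real_normed_vector"
  assumes "\<And>i. f i differentiable (at c)"
  obtains L where "L \<ge> 0" "\<forall>\<^sub>F x in nhds c. \<forall>i. norm (f i x - f i c) \<le> L * norm (x - c)"
proof -
  obtain L where L: "\<And>i. L i \<ge> 0" "\<And>i. \<forall>\<^sub>F x in nhds c. norm (f i x - f i c) \<le> L i * norm (x - c)"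
    using differentiable_local_bound[OF assms] by metis
  show thesis
  proof (rule that[of "\<Sum>i\<in>UNIV. L i"])
    show "(\<Sum>i\<in>UNIV. L i) \<ge> 0" using L(1) by (simp add: sum_nonneg)
    have "\<forall>\<^sub>F x in nhds c. \<forall>i. norm (f i x - f i c) \<le> L i * norm (x - c)"
      using L(2) by (rule eventually_all_finite)
    then show "\<forall>\<^sub>F x in nhds c. \<forall>i. norm (f i x - f i c) \<le> (\<Sum>i\<in>UNIV. L i) * norm (x - c)"
    proof eventually_elim
      case (elim x)
      have "L i * norm (x - c) \<le> (\<Sum>i\<in>UNIV. L i) * norm (x - c)" for i
        using L(1) by (intro mult_right_mono member_le_sum) auto
      then show ?case using elim order_trans by blast
    qed
  qed
qed

text \<open>
  Let \<open>B\<close> be the primitive of the coefficients \<open>b\<close>. By symmetry of \<open>S\<close>, the function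
  \<open>V = u(y) - 1/2 (B \<bullet> S B)\<close> has derivative \<open>\<Sum>\<^sub>k b\<^sub>k G\<^sub>k\<close>, where \<open>G\<^sub>k = (X\<^sub>k u)(y) - (S B)\<^sub>k\<close>. The derivative
  of \<open>G\<^sub>k\<close> in turn is \<open>\<Sum>\<^sub>l b\<^sub>l (S\<^sub>k\<^sub>l(y) - S\<^sub>k\<^sub>l(c))\<close>, of the order of the distance from \<open>c\<close>. With
  \<open>\<epsilon> = |y(0) - c|\<close> that distance is \<open>O(\<epsilon> + T)\<close>, hence \<open>G\<^sub>k = O(\<epsilon> + T (\<epsilon> + T))\<close> and \<open>V\<close> changes by
  \<open>O(T \<epsilon> + T\<^sup>3)\<close>. The quadratic term vanishes at time \<open>0\<close>, and dropping it at time \<open>T\<close> only lowers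
  the bound.
\<close>

theorem second_order_lower_bound:
  fixes X :: "'k::finite \<Rightarrow> real^'n \<Rightarrow> real^'n" and u :: "real^'n \<Rightarrow> real"
  assumes X: "\<And>k. Ck 2 (X k)" and u: "Ck 3 u"
    and tangent: "\<And>k. lie_deriv (X k) u c = 0"
  defines "S \<equiv> (\<chi> k l. lie_deriv (X l) (lie_deriv (X k) u) c)"
  assumes sym: "transpose S = S" and psd: "\<And>v. 0 \<le> v \<bullet> (S *v v)"
  shows "\<exists>K\<ge>0. \<exists>\<delta>>0. \<forall>b D T y. driven_curve X b D T y \<longrightarrow> norm (y 0 - c) < \<delta> \<longrightarrow> T < \<delta> \<longrightarrow>
           u (y T) \<ge> u (y 0) - K * (T * norm (y 0 - c) + T ^ 3)"
proof -
  define h where "h k = lie_deriv (X k) u" for k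
  define \<Sigma> where "\<Sigma> x = (\<chi> k l. lie_deriv (X l) (h k) x)" for x
  have Ckh: "Ck 2 (h k)" for k
    using Ck_lie_deriv[of 2 u] u X by (simp add: h_def numeral_3_eq_3 numeral_2_eq_2)
  have Ck\<Sigma>: "Ck 1 (lie_deriv (X l) (h k))" for k l
    using Ckh Ck_lie_deriv[of 1 "h k"] Ck_SucD[of 1 "X l"] X by (simp add: numeral_2_eq_2)
  have du: "u differentiable (at x)" and dh: "h k differentiable (at x)"
    and d\<Sigma>: "lie_deriv (X l) (h k) differentiable (at x)" for k l x
    using u Ckh Ck\<Sigma> by (auto simp: numeral_3_eq_3 numeral_2_eq_2)
  obtain L1 where L1: "L1 \<ge> 0" "\<forall>\<^sub>F x in nhds c. \<forall>k. norm (h k x - h k c) \<le> L1 * norm (x - c)"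
    using dh by (rule differentiable_family_local_bound)
  have "lie_deriv (X (snd kl)) (h (fst kl)) differentiable (at c)" for kl
    by (rule d\<Sigma>)
  then obtain L2 where L2: "L2 \<ge> 0" "\<forall>\<^sub>F x in nhds c. \<forall>kl.
      norm (lie_deriv (X (snd kl)) (h (fst kl)) x - lie_deriv (X (snd kl)) (h (fst kl)) c) \<le> L2 * norm (x - c)"
    by (rule differentiable_family_local_bound)
  define L where "L = max L1 L2"
  have "L \<ge> 0" using L1 by (simp add: L_def)
  obtain d where "d > 0" and
    d: "\<And>x k. norm (x - c) < d \<Longrightarrow> \<bar>h k x - h k c\<bar> \<le> L1 * norm (x - c)"
       "\<And>x k l. norm (x - c) < d \<Longrightarrow> \<bar>\<Sigma> x $ k $ l - S $ k $ l\<bar> \<le> L2 * norm (x - c)"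
    using eventually_conj[OF L1(2) L2(2)]
    by (auto simp: eventually_nhds_metric dist_norm \<Sigma>_def S_def h_def)
  have L12: "L1 * norm (x - c) \<le> L * norm (x - c)" "L2 * norm (x - c) \<le> L * norm (x - c)" for x
    by (intro mult_right_mono; simp add: L_def)+
  have h_le: "\<bar>h k x\<bar> \<le> L * norm (x - c)" if "norm (x - c) < d" for k x
    using d(1)[OF that, of k] L12(1)[of x] tangent[of k] by (simp add: h_def)
  have \<Sigma>_le: "\<bar>\<Sigma> x $ k $ l - S $ k $ l\<bar> \<le> L * norm (x - c)" if "norm (x - c) < d" for k l x
    using d(2)[OF that, of k l] L12(2)[of x] by simp
  have "\<exists>M\<ge>0. \<forall>z\<in>cball c (d/2). (\<Sum>k\<in>UNIV. norm (X k z)) \<le> M"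
  proof -
    have "continuous_on (cball c (d/2)) (X k)" for k
      using X[of k] Ck_SucD[of 1 "X k"] Ck_SucD[of 0 "X k"] continuous_on_subset
      by (simp add: numeral_2_eq_2) blast
    then have "bounded ((\<lambda>z. \<Sum>k\<in>UNIV. norm (X k z)) ` cball c (d/2))"
      by (intro compact_imp_bounded compact_continuous_image continuous_intros) auto
    then obtain M where "\<forall>z\<in>cball c (d/2). norm (\<Sum>k\<in>UNIV. norm (X k z)) \<le> M"
      unfolding bounded_iff by auto
    then show ?thesis by (intro exI[of _ "max M 0"]) auto
  qed
  then obtain M where M: "0 \<le> M" "\<And>z. z \<in> cball c (d/2) \<Longrightarrow> (\<Sum>k\<in>UNIV. norm (X k z)) \<le> M"
    by blast
  define N where "N = real CARD('k)"
  have "N \<ge> 0" by (simp add: N_def)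
  \<comment> \<open>The constants come from collecting powers in \<open>W * T\<close> at the end; \<open>\<delta>\<close> keeps curves in the ball of radius \<open>d / 2\<close>.\<close>
  define K where "K = N * L + N * N * L * (1 + M)"
  define \<delta> where "\<delta> = min 1 ((d / 2) / (M + 2))"
  have "K \<ge> 0" "\<delta> > 0"
    using \<open>L \<ge> 0\<close> M(1) \<open>d > 0\<close> \<open>N \<ge> 0\<close> by (auto simp: K_def \<delta>_def add_nonneg_pos)
  have key: "u (y T) \<ge> u (y 0) - K * (T * norm (y 0 - c) + T ^ 3)"
    if curve: "driven_curve X b D T y" and near: "norm (y 0 - c) < \<delta>" "T < \<delta>" for b D T y
  proof -
    interpret driven_curve X b D T y by (rule curve)
    define \<epsilon> where "\<epsilon> = norm (y 0 - c)"
    have "\<epsilon> \<ge> 0" "T \<le> 1" using near by (auto simp: \<epsilon>_def \<delta>_def)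
    have small: "norm (y 0 - c) + M * T < d / 2"
    proof -
      have "norm (y 0 - c) + M * T \<le> norm (y 0 - c) + (M + 1) * T" using T by (simp add: algebra_simps)
      also have "\<dots> < \<delta> + (M + 1) * \<delta>"
        using near M(1) by (intro add_less_le_mono mult_left_mono) auto
      also have "\<dots> = (M + 2) * \<delta>" by (simp add: algebra_simps)
      also have "\<dots> \<le> (M + 2) * ((d / 2) / (M + 2))"
        using M(1) by (intro mult_left_mono) (auto simp: \<delta>_def)
      also have "\<dots> = d / 2"
        using M(1) nonzero_mult_div_cancel_left[of "M + 2" "d / 2"]
        by (simp only: times_divide_eq_right[of "M + 2" "d / 2"])
      finally show ?thesis .
    qed
    define \<rho> where "\<rho> = \<epsilon> + M * T"
    have "\<rho> \<ge> 0" using \<open>\<epsilon> \<ge> 0\<close> M(1) T by (simp add: \<rho>_def)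
    have close: "norm (y s - c) \<le> \<rho>" "norm (y s - c) < d" if s: "s \<in> {0..T}" for s
    proof -
      have "norm (y s - c) \<le> norm (y s - y 0) + \<epsilon>"
        using norm_triangle_ineq[of "y s - y 0" "y 0 - c"] by (simp add: \<epsilon>_def)
      also have "\<dots> \<le> M * s + \<epsilon>" using stays_close(1)[OF M small s] by simp
      also have "M * s \<le> M * T" using s M(1) by (intro mult_left_mono) auto
      finally show "norm (y s - c) \<le> \<rho>" by (simp add: \<rho>_def)
      show "norm (y s - c) < d" using stays_close(2)[OF M small s] \<open>d > 0\<close> by simp
    qed
    have along: "((\<lambda>s. f (y s)) has_vector_derivative (\<Sum>k\<in>UNIV. b s $ k * lie_deriv (X k) f (y s))) (at s)"
      if "s \<in> {0<..<T} - D" "f differentiable (at (y s))" for f s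
      using grad_along_curve[OF y'[OF that(1)] that(2)]
      by (simp add: inner_sum_right lie_deriv_def)
    have cont: "continuous_on {0..T} (\<lambda>s. f (y s))" if "\<And>x. f differentiable (at x)" for f :: "real^'n \<Rightarrow> real"
      by (rule continuous_on_compose2[OF _ continuous_y, of UNIV])
         (auto intro!: continuous_at_imp_continuous_on differentiable_imp_continuous_within that)
    define G where "G k s = h k (y s) - (S *v B s) $ k" for k s
    have G_le: "\<bar>G k s\<bar> \<le> L * \<epsilon> + N * L * \<rho> * T" if s: "s \<in> {0..T}" for k s
    proof -
      have "norm (G k s - G k 0) \<le> (N * L * \<rho>) * (s - 0)"
      proof (rule norm_increment_le[OF finite_D])
        show "continuous_on {0..s} (G k)"
          unfolding G_def matrix_vector_mult_def
          using s continuous_on_subset[OF cont[OF dh]] continuous_on_subset[OF continuous_B]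
          by (intro continuous_on_diff) (auto intro!: continuous_intros)
        fix r assume r: "r \<in> {0<..<s} - D"
        then have r': "r \<in> {0<..<T} - D" and "r \<in> {0..T}" using s by auto
        let ?G' = "\<Sum>l\<in>UNIV. b r $ l * (\<Sigma> (y r) $ k $ l - S $ k $ l)"
        have "((\<lambda>s. (S *v B s) $ k) has_vector_derivative (S *v b r) $ k) (at r)"
          by (rule bounded_linear.has_vector_derivative[OF _ B'[OF r']])
             (rule bounded_linear_compose[OF bounded_linear_vec_nth matrix_vector_mul_bounded_linear])
        from has_vector_derivative_diff[OF along[OF r' dh[of k]] this]
        show "(G k has_vector_derivative ?G') (at r)"
          by (simp add: G_def[abs_def] \<Sigma>_def matrix_vector_mult_def right_diff_distrib sum_subtractf mult.commute)
        have "\<bar>?G'\<bar> \<le> (\<Sum>l\<in>(UNIV::'k set). L * \<rho>)"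
        proof (rule order_trans[OF sum_abs sum_mono])
          fix l
          have "\<bar>b r $ l * (\<Sigma> (y r) $ k $ l - S $ k $ l)\<bar> \<le> \<bar>\<Sigma> (y r) $ k $ l - S $ k $ l\<bar>"
            using b_le_1[OF \<open>r \<in> {0..T}\<close>, of l] by (simp add: abs_mult mult_left_le_one_le)
          also have "\<dots> \<le> L * norm (y r - c)" using close \<open>r \<in> {0..T}\<close> by (intro \<Sigma>_le) auto
          also have "\<dots> \<le> L * \<rho>" using close \<open>r \<in> {0..T}\<close> \<open>L \<ge> 0\<close> by (intro mult_left_mono) auto
          finally show "\<bar>b r $ l * (\<Sigma> (y r) $ k $ l - S $ k $ l)\<bar> \<le> L * \<rho>" .
        qed
        then show "norm ?G' \<le> N * L * \<rho>" by (simp add: N_def)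
      qed (use s \<open>N \<ge> 0\<close> \<open>L \<ge> 0\<close> \<open>\<rho> \<ge> 0\<close> in auto)
      moreover have "N * L * \<rho> * s \<le> N * L * \<rho> * T"
        using s \<open>N \<ge> 0\<close> \<open>L \<ge> 0\<close> \<open>\<rho> \<ge> 0\<close> by (intro mult_left_mono) auto
      moreover have "\<bar>G k 0\<bar> \<le> L * \<epsilon>"
        using h_le[of "y 0" k] close(2)[of 0] T by (simp add: G_def B_0 \<epsilon>_def)
      ultimately show ?thesis by simp
    qed
    define V where "V s = u (y s) - 1/2 * (B s \<bullet> (S *v B s))" for s
    define W where "W = N * (L * \<epsilon> + N * L * \<rho> * T)"
    have "norm (V T - V 0) \<le> W * (T - 0)"
    proof (rule norm_increment_le[OF finite_D])
      show "continuous_on {0..T} V"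
        unfolding V_def by (intro continuous_intros cont du continuous_B
           bounded_linear.continuous_on[OF matrix_vector_mul_bounded_linear])
      fix s assume s: "s \<in> {0<..<T} - D"
      let ?V' = "\<Sum>k\<in>UNIV. b s $ k * G k s"
      have "b s \<bullet> (S *v B s) = B s \<bullet> (S *v b s)"
        by (metis dot_lmul_matrix inner_commute sym transpose_matrix_vector)
      then have V': "?V' = (\<Sum>k\<in>UNIV. b s $ k * h k (y s))
          - 1/2 * (B s \<bullet> (S *v b s) + b s \<bullet> (S *v B s))"
        by (simp add: G_def right_diff_distrib sum_subtractf inner_vec_def)
      have "((\<lambda>s. B s \<bullet> (S *v B s)) has_vector_derivative (B s \<bullet> (S *v b s) + b s \<bullet> (S *v B s))) (at s)"
        by (intro bounded_bilinear.has_vector_derivative[OF bounded_bilinear_inner]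
            bounded_linear.has_vector_derivative[OF matrix_vector_mul_bounded_linear] B' s)
      then show "(V has_vector_derivative ?V') (at s)"
        unfolding V_def V' h_def
        by (intro has_vector_derivative_diff has_vector_derivative_mult_right along s du)
      have "\<bar>?V'\<bar> \<le> (\<Sum>k\<in>(UNIV::'k set). L * \<epsilon> + N * L * \<rho> * T)"
      proof (rule order_trans[OF sum_abs sum_mono])
        fix k
        have "\<bar>b s $ k * G k s\<bar> \<le> \<bar>G k s\<bar>"
          using b_le_1[of s k] s by (simp add: abs_mult mult_left_le_one_le)
        also have "\<dots> \<le> L * \<epsilon> + N * L * \<rho> * T" using s by (intro G_le) auto
        finally show "\<bar>b s $ k * G k s\<bar> \<le> L * \<epsilon> + N * L * \<rho> * T" .
      qed
      then show "norm ?V' \<le> W" by (simp add: N_def W_def)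
    qed (use T \<open>N \<ge> 0\<close> \<open>L \<ge> 0\<close> \<open>\<rho> \<ge> 0\<close> \<open>\<epsilon> \<ge> 0\<close> in \<open>auto simp: W_def\<close>)
    moreover have "V 0 = u (y 0)" "V T \<le> u (y T)"
      using psd[of "B T"] by (auto simp: V_def B_0)
    ultimately have "u (y 0) - W * T \<le> u (y T)" by simp
    moreover have "W * T \<le> K * (T * \<epsilon> + T ^ 3)"
    proof -
      have "T * T * \<epsilon> \<le> T * \<epsilon>" using \<open>T \<le> 1\<close> T \<open>\<epsilon> \<ge> 0\<close> by (simp add: mult_left_le_one_le mult_right_mono mult_left_le)
      then have "N * N * L * (T * T * \<epsilon>) \<le> N * N * L * (T * \<epsilon>)"
        using \<open>N \<ge> 0\<close> \<open>L \<ge> 0\<close> by (intro mult_left_mono) auto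
      moreover have "0 \<le> N * N * L * M * (T * \<epsilon>)" "0 \<le> N * N * L * T ^ 3" "0 \<le> N * L * T ^ 3"
        using \<open>N \<ge> 0\<close> \<open>L \<ge> 0\<close> M(1) T \<open>\<epsilon> \<ge> 0\<close> by auto
      ultimately show ?thesis
        by (simp add: W_def K_def \<rho>_def algebra_simps power3_eq_cube)
    qed
    ultimately show ?thesis by (simp add: \<epsilon>_def)
  qed
  show ?thesis
    using key \<open>K \<ge> 0\<close> \<open>\<delta> > 0\<close> by (intro exI[of _ K] conjI exI[of _ \<delta>]) auto
qed

section \<open>Affine systems\<close>

text \<open>
  The index \<open>None\<close> is the drift; its coefficient in \<open>with_drift\<close> is the constant \<open>1\<close>.
\<close>

definition affine_fields :: "(real^'n \<Rightarrow> real^'n) \<Rightarrow> (real^'n \<Rightarrow> real^'m^'n) \<Rightarrow> 'm option \<Rightarrow> real^'n \<Rightarrow> real^'n" where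
  "affine_fields \<sigma>0 \<sigma> k = (case k of None \<Rightarrow> \<sigma>0 | Some i \<Rightarrow> (\<lambda>x. column i (\<sigma> x)))"

definition with_drift :: "real^'m \<Rightarrow> real^('m option)" where
  "with_drift a = (\<chi> k. case k of None \<Rightarrow> 1 | Some i \<Rightarrow> a $ i)"

lemma sum_UNIV_option:
  fixes f :: "'a::finite option \<Rightarrow> 'b::comm_monoid_add"
  shows "(\<Sum>k\<in>UNIV. f k) = f None + (\<Sum>i\<in>UNIV. f (Some i))"
  by (simp add: UNIV_option_conv sum.reindex)

lemma affine_velocity:
  "(\<Sum>k\<in>UNIV. with_drift a $ k *\<^sub>R affine_fields \<sigma>0 \<sigma> k x) = \<sigma>0 x + \<sigma> x *v a"
  by (simp add: sum_UNIV_option with_drift_def affine_fields_def matrix_mult_sum scalar_mult_eq_scaleR)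

lemma Ck_affine_fields:
  fixes \<sigma> :: "real^'a \<Rightarrow> real^'b^'a"
  assumes "Ck n \<sigma>0" "Ck n \<sigma>"
  shows "Ck n (affine_fields \<sigma>0 \<sigma> k)"
proof (cases k)
  case (Some i)
  have "bounded_linear (\<lambda>A :: real^'b^'a. column i A)"
    by (intro linear_conv_bounded_linear[THEN iffD1] linearI) (auto simp: column_def vec_eq_iff)
  then show ?thesis using Some assms Ck_bounded_linear by (auto simp: affine_fields_def)
qed (simp add: affine_fields_def assms)

lemma solution_is_driven_curve:
  assumes sol: "solution_on \<sigma>0 \<sigma> a x \<tau> y" and adm: "admissible_control a"
    and T: "0 \<le> T" "ereal T < \<tau>"
    and X: "\<And>k. continuous_on UNIV (affine_fields \<sigma>0 \<sigma> k)"
  obtains D where "driven_curve (affine_fields \<sigma>0 \<sigma>) (\<lambda>s. with_drift (a s)) D T y"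
    and "y 0 = x"
proof -
  define F where "F s = \<sigma>0 (y s) + \<sigma> (y s) *v a s" for s
  have F: "(F has_integral (y t - x)) {0..t}" if "t \<in> {0..T}" for t
  proof -
    have "ereal t < \<tau>" using that T(2) le_less_trans[of "ereal t" "ereal T" \<tau>] by simp
    then show ?thesis using sol that by (auto simp: solution_on_def F_def[abs_def])
  qed
  have "(F has_integral (y 0 - x)) {0}" using F[of 0] T(1) by simp
  then have "y 0 - x = 0" by (rule has_integral_unique[OF _ has_integral_refl(2)])
  then have y0: "y 0 = x" by simp
  have y: "integral {0..t} F + x = y t" if "t \<in> {0..T}" for t
    using integral_unique[OF F[OF that]] by simp
  have int: "F integrable_on {0..T}"
    by (rule has_integral_integrable[OF F]) (simp add: T(1))
  have "continuous_on {0..T} (\<lambda>t. integral {0..t} F + x)"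
    by (intro continuous_intros indefinite_integral_continuous_1 int)
  then have cont: "continuous_on {0..T} y"
    by (rule continuous_on_eq) (rule y)
  obtain D where
    "finite D \<and> (\<forall>s\<in>{0..T} - D. \<forall>\<^sub>F t in nhds s. a t = a s)"
    using admissible_control_locally_constant[OF adm T(1)] by (rule exE)
  note D = this[THEN conjunct1] and const = this[THEN conjunct2, THEN bspec]
  have cont_b: "isCont (\<lambda>s. with_drift (a s)) s" if s: "s \<in> {0..T} - D" for s
    by (intro continuous_at_locally_constant eventually_mono[OF const[OF s]]) simp
  have "driven_curve (affine_fields \<sigma>0 \<sigma>) (\<lambda>s. with_drift (a s)) D T y"
  proof
    fix s k assume "s \<in> {0..T}"
    then have "norm (a s) \<le> 1" using adm by (auto simp: admissible_control_def)
    then have "\<bar>a s $ i\<bar> \<le> 1" for i by (rule order_trans[OF component_le_norm_cart])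
    then show "\<bar>with_drift (a s) $ k\<bar> \<le> 1" by (cases k) (simp_all add: with_drift_def)
  next
    fix s assume s: "s \<in> {0<..<T} - D"
    have y_cont: "isCont y s"
      using cont s by (intro continuous_on_interior[of "{0..T}"]) auto
    have "isCont (affine_fields \<sigma>0 \<sigma> k) (y s)" for k
      using X by (simp add: continuous_on_eq_continuous_at)
    then have "isCont (\<lambda>s. affine_fields \<sigma>0 \<sigma> k (y s)) s" for k
      by (rule isCont_o2[OF y_cont])
    moreover have "s \<in> {0..T} - D" using s by simp
    then have "isCont (\<lambda>s. with_drift (a s) $ k) s" for k
      by (rule bounded_linear.isCont[OF bounded_linear_vec_nth cont_b])
    ultimately have "isCont (\<lambda>s. \<Sum>k\<in>UNIV. with_drift (a s) $ k *\<^sub>R affine_fields \<sigma>0 \<sigma> k (y s)) s"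
      by (intro continuous_sum continuous_scaleR)
    then have "isCont F s" by (simp add: affine_velocity F_def[abs_def])
    then have "((\<lambda>t. integral {0..t} F) has_vector_derivative F s) (at s)"
      using int s by (intro integral_has_vector_derivative_interior) auto
    then have "((\<lambda>t. integral {0..t} F + x) has_vector_derivative F s) (at s)"
      by (simp add: has_vector_derivative_add_const)
    then have "(y has_vector_derivative F s) (at s)"
      by (rule has_vector_derivative_transform_within_open[of _ _ _ "{0<..<T}"]) (use s y in auto)
    then show "(y has_vector_derivative (\<Sum>k\<in>UNIV. with_drift (a s) $ k *\<^sub>R affine_fields \<sigma>0 \<sigma> k (y s))) (at s)"
      by (simp add: affine_velocity F_def)
  qed (use T D cont cont_b in simp_all)
  from that[OF this y0] show thesis .
qed

lemma bordered_pos_semidef: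
  fixes S :: "real^('m::finite option)^('m option)"
  assumes border: "\<And>k. S $ None $ k = 0" "\<And>k. S $ k $ None = 0"
    and M: "\<And>i j. S $ Some i $ Some j = M $ i $ j"
    and sym: "transpose M = M" and psd: "\<And>v. 0 \<le> v \<bullet> (M *v v)"
  shows "transpose S = S" "0 \<le> v \<bullet> (S *v v)"
proof -
  have "S $ k $ l = S $ l $ k" for k l
    using border M sym by (cases k; cases l) (auto simp: transpose_def vec_eq_iff)
  then show "transpose S = S" by (simp add: transpose_def vec_eq_iff)
  have "v \<bullet> (S *v v) = (\<chi> i. v $ Some i) \<bullet> (M *v (\<chi> i. v $ Some i))"
    by (simp add: inner_vec_def matrix_vector_mult_def sum_UNIV_option border M)
  then show "0 \<le> v \<bullet> (S *v v)" using psd by simp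
qed

text \<open>
  A finite minimum time need not be attained, so a strict upper bound is what produces a control.
\<close>

lemma min_time_lessD:
  assumes "min_time \<sigma>0 \<sigma> \<T> x < c"
  obtains a t \<tau> y where "admissible_control a" "0 \<le> t" "ereal t < c" "ereal t < \<tau>"
    "solution_on \<sigma>0 \<sigma> a x \<tau> y" "y t \<in> \<T>"
  using assms unfolding min_time_def hitting_time_def trajectory_def
  by (auto simp: INF_less_iff Inf_less_iff)

theorem proposition5p5:
  fixes \<sigma>0 :: "real^'n \<Rightarrow> real^'n"
    and \<sigma> :: "real^'n \<Rightarrow> real^'m^'n"
    and u :: "real^'n \<Rightarrow> real"
    and xbar :: "real^'n"
    and C r s :: real
  assumes "Ck 2 \<sigma>0" and "Ck 2 \<sigma>" and "Ck 3 u"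
    and "grad u xbar \<noteq> 0"
    and "grad u xbar \<bullet> \<sigma>0 xbar = 0"
    and "\<forall>i. grad u xbar \<bullet> column i (\<sigma> xbar) = 0"
    and "grad (\<lambda>x. grad u x \<bullet> \<sigma>0 x) xbar \<bullet> \<sigma>0 xbar \<le> 0"
    and "C > 0" and "r > 0" and "1/3 < s" and "s \<le> 1/2"
    and "\<forall>x\<in>cball xbar r.
           min_time \<sigma>0 \<sigma> {x. u x \<le> u xbar} x \<le> ereal (C * norm (x - xbar) powr s)"
  shows "((\<exists>j. lie_bracket \<sigma>0 (\<lambda>x. column j (\<sigma> x)) xbar \<bullet> grad u xbar \<noteq> 0)
            \<or> \<not> pos_semidef (K_mat u \<sigma> xbar))
       \<or> (\<exists>a\<in>cball 0 1.
            grad (\<lambda>x. grad u x \<bullet> (\<sigma>0 x + \<sigma> x *v a)) xbar \<bullet> (\<sigma>0 xbar + \<sigma> xbar *v a) < 0)"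
proof (rule ccontr)
  assume "\<not> ?thesis"
  then have bracket: "\<And>j. lie_bracket \<sigma>0 (\<lambda>x. column j (\<sigma> x)) xbar \<bullet> grad u xbar = 0"
    and K: "pos_semidef (K_mat u \<sigma> xbar)"
    and nonneg: "\<And>a. norm a \<le> 1 \<Longrightarrow>
      0 \<le> lie_deriv (\<lambda>x. \<sigma>0 x + \<sigma> x *v a) (lie_deriv (\<lambda>x. \<sigma>0 x + \<sigma> x *v a) u) xbar"
    unfolding lie_deriv_def[abs_def] by (auto simp: not_less)
  define X where "X = affine_fields \<sigma>0 \<sigma>"
  have X_None: "X None = \<sigma>0" and X_Some: "\<And>i. X (Some i) = (\<lambda>x. column i (\<sigma> x))"
    by (auto simp: X_def affine_fields_def)
  have CkX: "Ck 2 (X k)" for k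
    unfolding X_def using assms(1,2) by (rule Ck_affine_fields)
  have dX: "X k differentiable (at x)" for k x using CkX[of k] by (simp add: numeral_2_eq_2)
  have Cku: "Ck 2 u" using Ck_SucD[of 2 u] assms(3) by (simp add: numeral_3_eq_3 numeral_2_eq_2)
  have "Ck 2 (lie_deriv (X k) u)" for k
    using Ck_lie_deriv[of 2 u] assms(3) CkX by (simp add: numeral_3_eq_3 numeral_2_eq_2)
  then have dh: "lie_deriv (X k) u differentiable (at x)" for k x by (simp add: numeral_2_eq_2)
  define S where "S = (\<chi> k l. lie_deriv (X l) (lie_deriv (X k) u) xbar)"
  have S_mat: "S $ Some i $ Some j = S_mat u \<sigma> xbar $ i $ j" for i j
    by (simp add: S_def S_mat_def X_Some lie_deriv_def[abs_def])
  have drift: "S $ None $ None = 0"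
    using nonneg[of 0] assms(7)
    by (simp add: S_def X_None lie_deriv_def[abs_def])
  \<comment> \<open>In direction \<open>axis i 1\<close> condition (2) reads as a quadratic polynomial without constant term.\<close>
  have anticommute: "S $ None $ Some i + S $ Some i $ None = 0" for i
  proof (rule linear_coefficient_eq_0)
    fix e :: real assume "\<bar>e\<bar> \<le> 1"
    then have "norm (e *\<^sub>R axis i 1 :: real^'m) \<le> 1" by simp
    moreover have "\<sigma>0 x + \<sigma> x *v (e *\<^sub>R axis i 1) = X None x + e *\<^sub>R X (Some i) x" for x
      by (simp add: X_None X_Some matrix_vector_mult_scaleR matrix_vector_mult_basis)
    ultimately show "0 \<le> e * (S $ None $ Some i + S $ Some i $ None) + e\<^sup>2 * S $ Some i $ Some i"
      using nonneg[of "e *\<^sub>R axis i 1"]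
        second_lie_deriv_add_scaled[OF dh[of None xbar] dh[of "Some i" xbar], of e] drift
      by (simp add: S_def add.commute)
  qed
  have commute: "S $ Some i $ None = S $ None $ Some i" for i
    using lie_deriv_commutator[OF Cku dX[of None xbar] dX[of "Some i" xbar]] bracket[of i]
    by (simp add: S_def X_None X_Some)
  have border: "S $ None $ k = 0" "S $ k $ None = 0" for k
    using drift anticommute commute by (cases k; force)+
  note K' = K[unfolded K_mat_def]
  have SS: "transpose S = S" "0 \<le> v \<bullet> (S *v v)" for v
    using bordered_pos_semidef[OF border S_mat pos_semidef_block_imp[OF K']] by auto
  have "lie_deriv (X k) u xbar = 0" for k
    using assms(5,6) by (cases k) (auto simp: X_None X_Some lie_deriv_def)
  from second_order_lower_bound[OF CkX assms(3) this SS[unfolded S_def]]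
  obtain \<kappa> \<delta> where "\<kappa> \<ge> 0" "\<delta> > 0" and lower:
    "\<And>b D T y. driven_curve X b D T y \<Longrightarrow> norm (y 0 - xbar) < \<delta> \<Longrightarrow> T < \<delta> \<Longrightarrow>
       u (y T) \<ge> u (y 0) - \<kappa> * (T * norm (y 0 - xbar) + T ^ 3)"
    by blast
  \<comment> \<open>The direction of steepest ascent of \<open>u\<close>, as a unit vector.\<close>
  define p where "p = sgn (grad u xbar)"
  define g where "g = norm (grad u xbar)"
  have "g > 0" "norm p = 1" using assms(4) by (auto simp: g_def p_def norm_sgn)
  have gp: "grad u xbar \<bullet> p = g"
    using assms(4) by (simp add: p_def g_def sgn_div_norm power2_norm_eq_inner[symmetric] power2_eq_square)
  have ascent: "\<forall>\<^sub>F \<epsilon> in at_right 0. u xbar + \<epsilon> * (g / 2) \<le> u (xbar + \<epsilon> *\<^sub>R p)"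
  proof -
    have du: "u differentiable (at x)" for x using Cku by (simp add: numeral_2_eq_2)
    have "((\<lambda>\<epsilon>. u (xbar + \<epsilon> *\<^sub>R p)) has_vector_derivative grad u (xbar + 0 *\<^sub>R p) \<bullet> p) (at 0)"
      by (rule grad_along_curve) (auto intro!: derivative_eq_intros du)
    then have "((\<lambda>\<epsilon>. u (xbar + \<epsilon> *\<^sub>R p)) has_real_derivative g) (at 0)"
      by (simp add: gp has_real_derivative_iff_has_vector_derivative)
    then have "((\<lambda>\<epsilon>. (u (xbar + \<epsilon> *\<^sub>R p) - u xbar) / \<epsilon>) \<longlongrightarrow> g) (at 0)"
      by (simp add: DERIV_def)
    then have "((\<lambda>\<epsilon>. (u (xbar + \<epsilon> *\<^sub>R p) - u xbar) / \<epsilon>) \<longlongrightarrow> g) (at_right 0)"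
      by (rule tendsto_mono[OF at_le[OF subset_UNIV]])
    then have "\<forall>\<^sub>F \<epsilon> in at_right 0. g / 2 < (u (xbar + \<epsilon> *\<^sub>R p) - u xbar) / \<epsilon>"
      by (rule order_tendstoD) (use \<open>g > 0\<close> in simp)
    then show ?thesis using eventually_at_right_less[of 0]
      by eventually_elim (simp add: field_simps)
  qed
  have pow: "((\<lambda>\<epsilon>. \<epsilon> powr q) \<longlongrightarrow> 0) (at_right 0)" if "q > 0" for q :: real
    by (rule tendsto_zero_powrI[OF _ tendsto_const _ that])
       (auto intro: tendsto_ident_at eventually_mono[OF eventually_at_right_less[of 0]])
  \<comment> \<open>The factor \<open>2\<close> leaves room for a control that is only nearly optimal.\<close>
  define \<theta> where "\<theta> \<epsilon> = 2 * C * \<epsilon> powr s" for \<epsilon>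
  have "(\<theta> \<longlongrightarrow> 2 * C * 0) (at_right 0)"
    unfolding \<theta>_def using assms(10) by (intro tendsto_intros pow) auto
  then have short: "\<forall>\<^sub>F \<epsilon> in at_right 0. \<theta> \<epsilon> < \<delta>"
    by (rule order_tendstoD(2)) (use \<open>\<delta> > 0\<close> in simp)
  have "((\<lambda>\<epsilon>. \<kappa> * (\<theta> \<epsilon> + 8 * C ^ 3 * \<epsilon> powr (3 * s - 1))) \<longlongrightarrow>
      \<kappa> * (2 * C * 0 + 8 * C ^ 3 * 0)) (at_right 0)"
    using \<open>(\<theta> \<longlongrightarrow> 2 * C * 0) (at_right 0)\<close> assms(10) by (intro tendsto_intros pow) auto
  then have negligible: "\<forall>\<^sub>F \<epsilon> in at_right 0. \<kappa> * (\<theta> \<epsilon> + 8 * C ^ 3 * \<epsilon> powr (3 * s - 1)) < g / 2"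
    by (rule order_tendstoD(2)) (use \<open>g > 0\<close> in simp)
  have "\<forall>\<^sub>F \<epsilon> in at_right (0::real). \<epsilon> < min r \<delta>"
    by (rule order_tendstoD(2)[OF tendsto_ident_at]) (use assms(9) \<open>\<delta> > 0\<close> in simp)
  with ascent short negligible eventually_at_right_less[of 0]
  have "\<forall>\<^sub>F \<epsilon> in at_right (0::real). False"
  proof eventually_elim
    case (elim \<epsilon>)
    define x where "x = xbar + \<epsilon> *\<^sub>R p"
    have nx: "norm (x - xbar) = \<epsilon>" using elim \<open>norm p = 1\<close> by (simp add: x_def)
    have "x \<in> cball xbar r" using nx elim by (simp add: dist_norm norm_minus_commute)
    then have "min_time \<sigma>0 \<sigma> {x. u x \<le> u xbar} x \<le> ereal (C * \<epsilon> powr s)"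
      using assms(12) nx by blast
    also have "\<dots> < ereal (\<theta> \<epsilon>)" using elim assms(8) by (simp add: \<theta>_def)
    finally obtain a t \<tau> y where a: "admissible_control a" and t: "0 \<le> t" "t < \<theta> \<epsilon>" "ereal t < \<tau>"
      and sol: "solution_on \<sigma>0 \<sigma> a x \<tau> y" and hit: "u (y t) \<le> u xbar"
      by (rule min_time_lessD) auto
    have cX: "continuous_on UNIV (affine_fields \<sigma>0 \<sigma> k)" for k
      using Ck_SucD[of 0 "X k"] Ck_SucD[of 1 "X k"] CkX[of k] by (simp add: numeral_2_eq_2 X_def)
    obtain D where "driven_curve X (\<lambda>s. with_drift (a s)) D t y" "y 0 = x"
      by (rule solution_is_driven_curve[OF sol a t(1,3) cX, folded X_def])
    with lower[of "\<lambda>s. with_drift (a s)" D t y] nx elim t(2)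
    have "u x - \<kappa> * (t * \<epsilon> + t ^ 3) \<le> u xbar" using hit by simp
    then have "\<epsilon> * (g / 2) \<le> \<kappa> * (t * \<epsilon> + t ^ 3)" using elim by (simp add: x_def)
    also have "\<dots> \<le> \<kappa> * (\<theta> \<epsilon> * \<epsilon> + \<theta> \<epsilon> ^ 3)"
      using t \<open>\<kappa> \<ge> 0\<close> elim by (intro mult_left_mono add_mono mult_right_mono power_mono) auto
    also have "\<theta> \<epsilon> ^ 3 = \<epsilon> * (8 * C ^ 3 * \<epsilon> powr (3 * s - 1))"
    proof -
      have "(\<epsilon> powr s) ^ 3 = \<epsilon> powr (1 + (3 * s - 1))"
        using elim by (simp add: powr_power mult.commute)
      also have "\<dots> = \<epsilon> * \<epsilon> powr (3 * s - 1)" using elim by (subst powr_add) simp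
      finally show ?thesis by (simp add: \<theta>_def power_mult_distrib)
    qed
    finally have "\<epsilon> * (g / 2) \<le> \<epsilon> * (\<kappa> * (\<theta> \<epsilon> + 8 * C ^ 3 * \<epsilon> powr (3 * s - 1)))"
      by (simp add: algebra_simps)
    then have "g / 2 \<le> \<kappa> * (\<theta> \<epsilon> + 8 * C ^ 3 * \<epsilon> powr (3 * s - 1))"
      using elim mult_le_cancel_left_pos by blast
    then show False using elim by linarith
  qed
  then show False by simp
qed

end
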